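(* Let $S$ be a finitely generated positive cancelative commutative semigroup and $E\subset S\setminus\{0\}$ a nonempty finite subset. Then the Poincaré series $P=P_S=\sum_{m\in S}t^m\in\hat R=\mathbb{Z}[[S]]$ satisfies the following two formulas: (1) $$P=\frac{\sum_{m\in S}(-1)^{\#\mathrm{supp}(m)}\,\tilde\chi(T_m^\vee)\,t^m}{\prod_{e\in E}(1-t^e)},$$ (2) $$P=\frac{\sum_{m\in S}(-1)^{\#E}\,\tilde\chi(\overline{T}_m^\vee)\,t^m}{\prod_{e\in E}(1-t^e)}.$$
   Context: Semigroups: a semigroup here is a set with an associative operation $+$ and a neutral element $0$. It is cancelative if $m+n=m'+n$ implies $m=m'$; positive if $m+n=0$ implies $m=n=0$; finitely generated if finitely many elements generate it under linear combinations with nonnegative integer coefficients. $S$ is viewed inside the abelian group $G(S)$ it generates (its group of differences); differences $m-n$ are taken in $G(S)$ (which may have torsion). Rings: $\hat R=\mathbb{Z}[[S]]$ is the ring of all formal sums $\sum_{m\in S}a_mt^m$, $a_m\in\mathbb{Z}$, with multiplication determined by $t^mt^n=t^{m+n}$ (well defined because each $m\in S$ can be written as $m=n+n'$ with $n,n'\in S$ in only finitely many ways). For $e\in S\setminus\{0\}$, $1-t^e$ is a unit in $\hat R$ with inverse $\sum_{i\ge0}t^{ie}$; fractions mean multiplication by the inverse of the denominator in $\hat R$. Complexes: for $J\subset E$ let $e_J=\sum_{e\in J}e$ (with $e_\emptyset=0$). For $m\in S$, $T_m=\{J\subset E\mid m-e_J\in S\}$, a simplicial complex containing the empty face, and $\mathrm{supp}(m)=\{e\in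 E\mid m-e\in S\}=\{e\in E\mid\{e\}\in T_m\}$. The Alexander dual and relative Alexander dual are $$T_m^\vee=\{J\subset\mathrm{supp}(m)\mid\mathrm{supp}(m)\setminus J\notin T_m\},\qquad \overline{T}_m^\vee=\{L\subset E\mid E\setminus L\notin T_m\}.$$ For a (possibly void) complex $T$, $\tilde\chi(T)=\sum_{J\in T}(-1)^{\#J-1}$ (so $\tilde\chi=0$ for the void complex having no faces at all). Convention: if $T_m=\{\emptyset\}$ (i.e. $\mathrm{supp}(m)=\emptyset$), then $T_m^\vee$ is not considered and $\tilde\chi(T_m^\vee)$ is defined to be $1$. *)

theory Defs
  imports Complex_Main
begin

section \<open>Semigroups\<close>

context comm_monoid_add
begin

primrec nsmul :: "nat \<Rightarrow> 'a \<Rightarrow> 'a" where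
  "nsmul 0 a = 0"
| "nsmul (Suc k) a = a + nsmul k a"

lemma nsmul_add: "nsmul (i + j) a = nsmul i a + nsmul j a"
  by (induction i) (auto simp: add.assoc)

end

text \<open>The semigroup \<open>S\<close> is the universe of a type of the following class. The class
  \<^class>\<open>cancel_ab_semigroup_add\<close> is avoided on purpose, because it would equip \<open>S\<close> with a
  total subtraction; differences are taken in the group of differences below.\<close>

class fg_positive_cancel_semigroup = comm_monoid_add + cancel_semigroup_add +
  assumes positive: "m + n = 0 \<Longrightarrow> m = 0 \<and> n = 0"
  assumes finitely_generated: "\<exists>A. finite A \<and> (\<forall>m. \<exists>c. m = (\<Sum>a\<in>A. nsmul (c a) a))"

section \<open>The group of differences\<close>

definition diff_rel ::
  "'a \<times> 'a \<Rightarrow> 'a \<times> 'a::{comm_monoid_add,cancel_semigroup_add} \<Rightarrow> bool" where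
  "diff_rel p q \<longleftrightarrow> fst p + snd q = fst q + snd p"

lemma equivp_diff_rel:
  "equivp (diff_rel :: 'a \<times> 'a \<Rightarrow> 'a \<times> 'a::{comm_monoid_add,cancel_semigroup_add} \<Rightarrow> bool)"
proof (rule equivpI)
  show "reflp (diff_rel :: 'a \<times> 'a \<Rightarrow> _)"
    by (simp add: reflp_def diff_rel_def)
  show "symp (diff_rel :: 'a \<times> 'a \<Rightarrow> _)"
    by (auto simp: symp_def diff_rel_def)
  show "transp (diff_rel :: 'a \<times> 'a \<Rightarrow> _)"
  proof (rule transpI)
    fix p q r :: "'a \<times> 'a"
    assume 1: "diff_rel p q" and 2: "diff_rel q r"
    have "(fst p + snd r) + snd q = (fst p + snd q) + snd r"
      by (simp add: ac_simps)
    also have "\<dots> = (fst q + snd p) + snd r"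
      using 1 by (simp add: diff_rel_def)
    also have "\<dots> = (fst q + snd r) + snd p"
      by (simp add: ac_simps)
    also have "\<dots> = (fst r + snd q) + snd p"
      using 2 by (simp add: diff_rel_def)
    also have "\<dots> = (fst r + snd p) + snd q"
      by (simp add: ac_simps)
    finally show "diff_rel p r"
      by (simp add: diff_rel_def)
  qed
qed

quotient_type (overloaded) 'a diff_group =
  "'a \<times> 'a::{comm_monoid_add,cancel_semigroup_add}" / diff_rel
  by (rule equivp_diff_rel)

instantiation diff_group :: ("{comm_monoid_add,cancel_semigroup_add}") ab_group_add
begin

lift_definition zero_diff_group :: "'a diff_group" is "(0, 0)" .

lift_definition plus_diff_group :: "'a diff_group \<Rightarrow> 'a diff_group \<Rightarrow> 'a diff_group"
  is "\<lambda>p q. (fst p + fst q, snd p + snd q)"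
proof -
  fix p p' q q' :: "'a \<times> 'a"
  assume "diff_rel p p'" "diff_rel q q'"
  then have "(fst p + snd p') + (fst q + snd q') = (fst p' + snd p) + (fst q' + snd q)"
    by (simp add: diff_rel_def)
  then show "diff_rel (fst p + fst q, snd p + snd q) (fst p' + fst q', snd p' + snd q')"
    by (simp add: diff_rel_def ac_simps)
qed

lift_definition uminus_diff_group :: "'a diff_group \<Rightarrow> 'a diff_group"
  is "\<lambda>p. (snd p, fst p)"
  by (simp add: diff_rel_def ac_simps)

definition minus_diff_group :: "'a diff_group \<Rightarrow> 'a diff_group \<Rightarrow> 'a diff_group" where
  "minus_diff_group x y = x + - y"

instance
proof
  fix a b c :: "'a diff_group"
  show "a + b + c = a + (b + c)"
    by transfer (simp add: diff_rel_def ac_simps)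
  show "a + b = b + a"
    by transfer (simp add: diff_rel_def ac_simps)
  show "0 + a = a"
    by transfer (simp add: diff_rel_def)
  show "- a + a = 0"
    by transfer (simp add: diff_rel_def ac_simps)
  show "a - b = a + - b"
    by (rule minus_diff_group_def)
qed

end

lift_definition to_group :: "'a::{comm_monoid_add,cancel_semigroup_add} \<Rightarrow> 'a diff_group"
  is "\<lambda>m. (m, 0)" .

lemma to_group_add: "to_group (m + n) = to_group m + to_group n"
  by transfer (simp add: diff_rel_def)

lemma to_group_eq_iff: "to_group m = to_group n \<longleftrightarrow> m = n"
  by transfer (simp add: diff_rel_def)

lemma diff_in_range_iff: "to_group m - to_group n \<in> range to_group \<longleftrightarrow> (\<exists>k. m = n + k)"
proof -
  have "to_group m - to_group n = to_group k \<longleftrightarrow> m = n + k" for k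
    by (simp add: diff_eq_eq to_group_add[symmetric] to_group_eq_iff add.commute)
  then show ?thesis
    by auto
qed

section \<open>Finiteness of decompositions\<close>

lemma nat_seq_mono_subseq:
  fixes s :: "nat \<Rightarrow> nat"
  shows "\<exists>r::nat \<Rightarrow> nat. strict_mono r \<and> mono (\<lambda>i. s (r i))"
proof -
  obtain r :: "nat \<Rightarrow> nat" where r: "strict_mono r" "monoseq (\<lambda>i. s (r i))"
    using seq_monosub[of s] by blast
  show ?thesis
  proof (cases "mono (\<lambda>i. s (r i))")
    case True
    with r(1) show ?thesis by blast
  next
    case False
    with r(2) have dec: "j \<ge> i \<Longrightarrow> s (r j) \<le> s (r i)" for i j
      by (auto simp: monoseq_def monotone_def)
    obtain N where N: "\<And>i. s (r N) \<le> s (r i)"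
      using ex_has_least_nat[of "\<lambda>_. True" 0 "\<lambda>i. s (r i)"] by auto
    have "s (r (N + i)) = s (r N)" for i
      using dec[of N "N + i"] N[of "N + i"] by simp
    then have "mono (\<lambda>i. s (r (N + i)))"
      by (simp add: monotone_def)
    moreover have "strict_mono (\<lambda>i. r (N + i))"
      using r(1) by (simp add: strict_mono_def)
    ultimately show ?thesis by blast
  qed
qed

lemma nat_fun_seq_mono_subseq:
  fixes f :: "nat \<Rightarrow> 'b \<Rightarrow> nat"
  assumes "finite A"
  shows "\<exists>r::nat \<Rightarrow> nat. strict_mono r \<and> (\<forall>a\<in>A. mono (\<lambda>i. f (r i) a))"
  using assms
proof (induction A)
  case empty
  show ?case by (rule exI[of _ id]) (simp add: strict_mono_def)
next
  case (insert x A)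
  then obtain r :: "nat \<Rightarrow> nat"
    where r: "strict_mono r" "\<And>a. a \<in> A \<Longrightarrow> mono (\<lambda>i. f (r i) a)"
    by blast
  obtain q :: "nat \<Rightarrow> nat" where q: "strict_mono q" "mono (\<lambda>i. f (r (q i)) x)"
    using nat_seq_mono_subseq[of "\<lambda>i. f (r i) x"] by blast
  have "mono (\<lambda>i. f (r (q i)) a)" if "a \<in> insert x A" for a
  proof (cases "a = x")
    case True
    with q(2) show ?thesis by simp
  next
    case False
    with that have "a \<in> A" by simp
    show ?thesis
    proof (rule monoI)
      fix i j :: nat
      assume "i \<le> j"
      then have "q i \<le> q j"
        using q(1) by (simp add: strict_mono_less_eq)
      then show "f (r (q i)) a \<le> f (r (q j)) a"
        using r(2)[OF \<open>a \<in> A\<close>] by (simp add: monotone_def)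
    qed
  qed
  moreover have "strict_mono (\<lambda>i. r (q i))"
    using r(1) q(1) by (simp add: strict_mono_def)
  ultimately show ?case by blast
qed

lemma seq_chain_subseq:
  fixes x :: "nat \<Rightarrow> 'a::fg_positive_cancel_semigroup"
  shows "\<exists>r::nat \<Rightarrow> nat. strict_mono r \<and> (\<forall>i j. i \<le> j \<longrightarrow> (\<exists>u. x (r j) = x (r i) + u))"
proof -
  obtain A :: "'a set" where A: "finite A" "\<And>m. \<exists>c. m = (\<Sum>a\<in>A. nsmul (c a) a)"
    using finitely_generated by blast
  then obtain c where c: "\<And>m. m = (\<Sum>a\<in>A. nsmul (c m a) a)"
    by metis
  obtain r :: "nat \<Rightarrow> nat"
    where r: "strict_mono r" "\<And>a. a \<in> A \<Longrightarrow> mono (\<lambda>i. c (x (r i)) a)"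
    using nat_fun_seq_mono_subseq[OF A(1), of "\<lambda>i. c (x i)"] by blast
  have "\<exists>u. x (r j) = x (r i) + u" if "i \<le> j" for i j
  proof -
    let ?c = "\<lambda>i a. c (x (r i)) a"
    have *: "?c j a = ?c i a + (?c j a - ?c i a)" if "a \<in> A" for a
      using monoD[OF r(2)[OF that] \<open>i \<le> j\<close>] by simp
    have "x (r j) = (\<Sum>a\<in>A. nsmul (?c j a) a)"
      by (rule c)
    also have "\<dots> = (\<Sum>a\<in>A. nsmul (?c i a) a + nsmul (?c j a - ?c i a) a)"
      by (rule sum.cong[OF refl]) (metis * nsmul_add)
    also have "\<dots> = x (r i) + (\<Sum>a\<in>A. nsmul (?c j a - ?c i a) a)"
      by (simp add: sum.distrib c[of "x (r i)", symmetric])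
    finally show ?thesis by blast
  qed
  with r(1) show ?thesis by blast
qed

definition decomps :: "'a::comm_monoid_add \<Rightarrow> ('a \<times> 'a) set" where
  "decomps m = {(n, n'). n + n' = m}"

lemma mem_decomps [simp]: "(a, b) \<in> decomps m \<longleftrightarrow> a + b = m"
  by (simp add: decomps_def)

lemma finite_decomps: "finite (decomps (m::'a::fg_positive_cancel_semigroup))"
proof (rule ccontr)
  assume "infinite (decomps m)"
  then obtain z :: "nat \<Rightarrow> 'a \<times> 'a" where z: "inj z" "range z \<subseteq> decomps m"
    using infinite_countable_subset by blast
  define x y where "x i = fst (z i)" and "y i = snd (z i)" for i
  have xy: "x i + y i = m" for i
  proof -
    have "z i \<in> decomps m"
      using z(2) by blast
    then show ?thesis
      by (simp add: x_def y_def decomps_def case_prod_beta)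
  qed
  obtain r :: "nat \<Rightarrow> nat"
    where r: "strict_mono r" "\<And>i j. i \<le> j \<Longrightarrow> \<exists>u. x (r j) = x (r i) + u"
    using seq_chain_subseq[of x] by blast
  obtain q :: "nat \<Rightarrow> nat"
    where q: "strict_mono q" "\<And>i j. i \<le> j \<Longrightarrow> \<exists>v. y (r (q j)) = y (r (q i)) + v"
    using seq_chain_subseq[of "\<lambda>i. y (r i)"] by blast
  let ?i = "r (q 0)" and ?j = "r (q 1)"
  have lt: "q 0 < q 1" "?i < ?j"
    using q(1) r(1) by (simp_all add: strict_mono_def)
  obtain u where u: "x ?j = x ?i + u"
    using r(2)[of "q 0" "q 1"] lt by auto
  obtain v where v: "y ?j = y ?i + v"
    using q(2)[of 0 1] by auto
  have "m + (u + v) = (x ?i + u) + (y ?i + v)"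
    using xy[of ?i] by (simp add: ac_simps)
  also have "\<dots> = m + 0"
    using u v xy[of ?j] by simp
  finally have "u + v = 0"
    by (simp only: add_left_cancel)
  then have "u = 0" "v = 0"
    using positive by blast+
  with u v have "z ?i = z ?j"
    by (simp add: x_def y_def prod_eq_iff)
  with z(1) lt(2) show False
    by (metis injD less_irrefl)
qed

section \<open>The ring of formal sums\<close>

typedef 'a formal_series = "UNIV :: ('a \<Rightarrow> int) set"
  morphisms coeff formal_sum ..

setup_lifting type_definition_formal_series

lemma coeff_formal_sum [simp]: "coeff (formal_sum f) m = f m"
  by (simp add: formal_sum_inverse)

lemma formal_series_eqI: "(\<And>m. coeff f m = coeff g m) \<Longrightarrow> f = g"
  by (metis coeff_inverse ext)

definition tpow :: "'a \<Rightarrow> 'a formal_series" where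
  "tpow m = formal_sum (\<lambda>n. if n = m then 1 else 0)"

lemma coeff_tpow: "coeff (tpow m) n = (if n = m then 1 else 0)"
  by (simp add: tpow_def)

instantiation formal_series :: (fg_positive_cancel_semigroup) comm_ring_1
begin

definition zero_formal_series :: "'a formal_series" where
  "0 = formal_sum (\<lambda>_. 0)"

definition one_formal_series :: "'a formal_series" where
  "1 = tpow 0"

definition plus_formal_series :: "'a formal_series \<Rightarrow> 'a formal_series \<Rightarrow> 'a formal_series" where
  "f + g = formal_sum (\<lambda>m. coeff f m + coeff g m)"

definition uminus_formal_series :: "'a formal_series \<Rightarrow> 'a formal_series" where
  "- f = formal_sum (\<lambda>m. - coeff f m)"

definition minus_formal_series :: "'a formal_series \<Rightarrow> 'a formal_series \<Rightarrow> 'a formal_series" where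
  "f - g = formal_sum (\<lambda>m. coeff f m - coeff g m)"

definition times_formal_series :: "'a formal_series \<Rightarrow> 'a formal_series \<Rightarrow> 'a formal_series" where
  "f * g = formal_sum (\<lambda>m. \<Sum>(n, n')\<in>{(n, n'). n + n' = m}. coeff f n * coeff g n')"

lemma coeff_times: "coeff (f * g) m = (\<Sum>p\<in>decomps m. coeff f (fst p) * coeff g (snd p))"
  by (simp add: times_formal_series_def decomps_def case_prod_beta)

lemma coeff_tpow_times:
  "coeff (tpow e * g) m = (if \<exists>n. e + n = m then coeff g (THE n. e + n = m) else 0)"
proof (cases "\<exists>n. e + n = m")
  case True
  then obtain n where n: "e + n = m" by blast
  have the: "(THE n. e + n = m) = n"
    using n by (intro the_equality) auto
  have "coeff (tpow e * g) m = (\<Sum>p\<in>{(e, n)}. coeff (tpow e) (fst p) * coeff g (snd p))"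
    unfolding coeff_times
    by (rule sum.mono_neutral_right) (use n in \<open>auto simp: finite_decomps tpow_def\<close>)
  also have "\<dots> = coeff g n"
    by (simp add: tpow_def)
  finally show ?thesis
    using True the by simp
next
  case False
  then show ?thesis
    unfolding coeff_times
    by (auto intro!: sum.neutral simp: tpow_def)
qed

instance
proof
  fix a b c :: "'a formal_series"
  show "a + b + c = a + (b + c)" "a + b = b + a" "0 + a = a" "- a + a = 0" "a - b = a + - b"
    by (simp_all add: plus_formal_series_def zero_formal_series_def uminus_formal_series_def
        minus_formal_series_def coeff_inverse ac_simps)
  show "(a + b) * c = a * c + b * c"
    by (rule formal_series_eqI)
      (simp add: coeff_times plus_formal_series_def distrib_right sum.distrib)
  show "a * b = b * a"
  proof (rule formal_series_eqI)
    fix m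
    show "coeff (a * b) m = coeff (b * a) m"
      unfolding coeff_times
      by (rule sum.reindex_bij_witness[of _ prod.swap prod.swap]) (auto simp: add.commute)
  qed
  show "1 * a = a"
    by (rule formal_series_eqI) (simp add: one_formal_series_def coeff_tpow_times)
  have "coeff (0 :: 'a formal_series) 0 \<noteq> coeff 1 0"
    by (simp add: zero_formal_series_def one_formal_series_def tpow_def)
  then show "(0 :: 'a formal_series) \<noteq> 1"
    by metis
  show "a * b * c = a * (b * c)"
  proof (rule formal_series_eqI)
    fix m
    let ?h = "\<lambda>x y z. coeff a x * coeff b y * coeff c z"
    have "coeff (a * b * c) m =
        (\<Sum>p\<in>decomps m. \<Sum>q\<in>decomps (fst p). ?h (fst q) (snd q) (snd p))"
      by (simp add: coeff_times sum_distrib_right)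
    also have "\<dots> = (\<Sum>(p, q)\<in>(SIGMA p:decomps m. decomps (fst p)). ?h (fst q) (snd q) (snd p))"
      by (rule sum.Sigma) (auto simp: finite_decomps)
    also have "\<dots> = (\<Sum>(p, q)\<in>(SIGMA p:decomps m. decomps (snd p)). ?h (fst p) (fst q) (snd q))"
      by (rule sum.reindex_bij_witness[of _
            "\<lambda>(p, q). ((fst p + fst q, snd q), (fst p, fst q))"
            "\<lambda>(p, q). ((fst q, snd q + snd p), (snd q, snd p))"])
        (auto simp: add.assoc)
    also have "\<dots> = (\<Sum>p\<in>decomps m. \<Sum>q\<in>decomps (snd p). ?h (fst p) (fst q) (snd q))"
      by (rule sum.Sigma[symmetric]) (auto simp: finite_decomps)
    also have "\<dots> = coeff (a * (b * c)) m"
      by (simp add: coeff_times sum_distrib_left mult.assoc)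
    finally show "coeff (a * b * c) m = coeff (a * (b * c)) m" .
  qed
qed

end

lemma tpow_add: "tpow m * tpow n = tpow (m + n :: 'a::fg_positive_cancel_semigroup)"
proof (rule formal_series_eqI)
  fix k
  show "coeff (tpow m * tpow n) k = coeff (tpow (m + n)) k"
    by (auto simp: coeff_tpow_times coeff_tpow)
qed

text \<open>The inverse is meaningful for units only; all denominators used are units by
  \<open>prod_one_minus_tpow_unit\<close> below.\<close>

instantiation formal_series :: (fg_positive_cancel_semigroup) inverse
begin

definition inverse_formal_series :: "'a formal_series \<Rightarrow> 'a formal_series" where
  "inverse f = (THE g. f * g = (1 :: 'a formal_series))"

definition divide_formal_series :: "'a formal_series \<Rightarrow> 'a formal_series \<Rightarrow> 'a formal_series" where
  "f div g = f * inverse (g :: 'a formal_series)"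

instance ..

end

lemma formal_series_inverse_unique:
  fixes f g :: "'a::fg_positive_cancel_semigroup formal_series"
  assumes "f * g = 1"
  shows "inverse f = g"
  unfolding inverse_formal_series_def
proof (rule the_equality)
  fix h
  assume "f * h = 1"
  then have "g * (f * h) = g"
    by simp
  then show "h = g"
    using assms by (metis mult.assoc mult.commute mult_1)
qed (rule assms)

lemma one_minus_tpow_inverse:
  fixes e :: "'a::fg_positive_cancel_semigroup"
  assumes "e \<noteq> 0"
  shows "(1 - tpow e) * formal_sum (\<lambda>m. if \<exists>i. m = nsmul i e then 1 else 0) = 1"
    (is "_ * ?g = _")
proof (rule formal_series_eqI)
  fix m
  have "coeff ((1 - tpow e) * ?g) m = coeff (?g - tpow e * ?g) m"
    by (simp only: left_diff_distrib mult_1)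
  also have "\<dots> = coeff ?g m - coeff (tpow e * ?g) m"
    by (simp add: minus_formal_series_def)
  also have "\<dots> = coeff 1 m"
  proof (cases "\<exists>n. e + n = m")
    case True
    then obtain n where n: "e + n = m" by blast
    then have "m \<noteq> 0"
      using assms positive by blast
    have "(\<exists>i. m = nsmul i e) \<longleftrightarrow> (\<exists>i. n = nsmul i e)"
    proof
      assume "\<exists>i. m = nsmul i e"
      then obtain i where "m = nsmul i e" by blast
      with \<open>m \<noteq> 0\<close> n show "\<exists>i. n = nsmul i e"
        by (cases i) auto
    next
      assume "\<exists>i. n = nsmul i e"
      then obtain i where "n = nsmul i e" by blast
      with n have "m = nsmul (Suc i) e" by simp
      then show "\<exists>i. m = nsmul i e" by blast
    qed
    moreover have "coeff (tpow e * ?g) m = coeff ?g n"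
      using n by (auto simp: coeff_tpow_times)
    moreover have "coeff 1 m = 0"
      using \<open>m \<noteq> 0\<close> by (simp add: one_formal_series_def coeff_tpow)
    ultimately show ?thesis
      by simp
  next
    case False
    have "(\<exists>i. m = nsmul i e) \<longleftrightarrow> m = 0"
    proof
      assume "\<exists>i. m = nsmul i e"
      then obtain i where "m = nsmul i e" by blast
      with False show "m = 0"
        by (cases i) auto
    next
      assume "m = 0"
      then have "m = nsmul 0 e" by simp
      then show "\<exists>i. m = nsmul i e" by blast
    qed
    moreover have "coeff (tpow e * ?g) m = 0"
      using False by (simp add: coeff_tpow_times)
    ultimately show ?thesis
      by (simp add: one_formal_series_def coeff_tpow)
  qed
  finally show "coeff ((1 - tpow e) * ?g) m = coeff 1 m" .
qed

lemma prod_one_minus_tpow_unit: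
  fixes E :: "'a::fg_positive_cancel_semigroup set"
  assumes "0 \<notin> E"
  shows "(\<Prod>e\<in>E. 1 - tpow e) * inverse (\<Prod>e\<in>E. 1 - tpow e) = 1"
proof -
  have "(\<Prod>e\<in>E. 1 - tpow e) *
      (\<Prod>e\<in>E. formal_sum (\<lambda>m. if \<exists>i. m = nsmul i e then 1 else 0)) = 1"
    using assms
    by (subst prod.distrib[symmetric], intro prod.neutral ballI one_minus_tpow_inverse) auto
  then show ?thesis
    by (metis formal_series_inverse_unique)
qed

definition poincare_series :: "'a formal_series" where
  "poincare_series = formal_sum (\<lambda>_. 1)"

section \<open>Simplicial complexes\<close>

definition complex_at ::
  "'a::fg_positive_cancel_semigroup set \<Rightarrow> 'a \<Rightarrow> 'a set set" where
  "complex_at E m = {J. J \<subseteq> E \<and> to_group m - to_group (\<Sum>e\<in>J. e) \<in> range to_group}"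

definition supp :: "'a::fg_positive_cancel_semigroup set \<Rightarrow> 'a \<Rightarrow> 'a set" where
  "supp E m = {e \<in> E. to_group m - to_group e \<in> range to_group}"

definition alexander_dual ::
  "'a::fg_positive_cancel_semigroup set \<Rightarrow> 'a \<Rightarrow> 'a set set" where
  "alexander_dual E m = {J. J \<subseteq> supp E m \<and> supp E m - J \<notin> complex_at E m}"

definition relative_alexander_dual ::
  "'a::fg_positive_cancel_semigroup set \<Rightarrow> 'a \<Rightarrow> 'a set set" where
  "relative_alexander_dual E m = {L. L \<subseteq> E \<and> E - L \<notin> complex_at E m}"

text \<open>The exponent is \<open>#J + 1\<close> instead of \<open>#J - 1\<close>, which has the same parity: subtraction of
  natural numbers would be wrong for \<open>J = {}\<close>, which contributes \<open>-1\<close>.\<close>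

definition reduced_euler_char :: "'a set set \<Rightarrow> int" where
  "reduced_euler_char T = (\<Sum>J\<in>T. (-1) ^ (card J + 1))"

text \<open>The value \<open>1\<close> for empty support is a convention. Without it one would get \<open>0\<close>, since
  \<^const>\<open>alexander_dual\<close> is then void.\<close>

definition dual_euler_char :: "'a::fg_positive_cancel_semigroup set \<Rightarrow> 'a \<Rightarrow> int" where
  "dual_euler_char E m =
    (if complex_at E m = {{}} then 1 else reduced_euler_char (alexander_dual E m))"

end

theory Submission
  imports Defs
begin

text \<open>The coefficient of \<open>t\<^sup>m\<close> in \<open>P \<cdot> \<Prod>\<^sub>e (1 - t\<^sup>e)\<close> is the alternating
  sum of \<open>(-1)\<^sup>#\<^sup>J\<close> over the faces \<open>J\<close> of \<open>T\<^sub>m\<close>. Over all subsets of a nonempty finite vertex set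
  this sum vanishes, so it may be taken over the nonfaces with the opposite sign, and complementing
  nonfaces gives the Euler characteristic of the Alexander dual.\<close>

lemma coeff_uminus: "coeff (- f) m = - coeff f m"
  by (simp add: uminus_formal_series_def)

lemma coeff_sum: "coeff (\<Sum>i\<in>A. f i) m = (\<Sum>i\<in>A. coeff (f i) m)"
  by (induction A rule: infinite_finite_induct)
    (simp_all add: zero_formal_series_def plus_formal_series_def)

lemma coeff_minus_one_power_times: "coeff ((-1) ^ n * f) m = (-1) ^ n * coeff f m"
  by (cases "even n") (simp_all add: coeff_uminus)

lemma prod_tpow: "(\<Prod>e\<in>J. tpow e) = tpow (\<Sum>J)"
  by (induction J rule: infinite_finite_induct)
    (simp_all add: one_formal_series_def tpow_add)

text \<open>Expanding the product contributes, for each subset \<open>J\<close> of \<open>E\<close>,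
  the signed monomial that picks \<open>- tpow e\<close> from the factors with
  \<open>e \<in> J\<close>.\<close>

lemma coeff_times_prod_one_minus_tpow:
  fixes E :: "'a::fg_positive_cancel_semigroup set"
  assumes "finite E"
  shows "coeff (f * (\<Prod>e\<in>E. 1 - tpow e)) m =
    (\<Sum>J\<in>Pow E. (-1) ^ card J * coeff (tpow (\<Sum>J) * f) m)"
proof -
  have "f * (\<Prod>e\<in>E. 1 - tpow e) = (\<Sum>J\<in>Pow E. (-1) ^ card J * (tpow (\<Sum>J) * f))"
    using assms by (simp add: prod_diff_conv_sum prod_tpow sum_distrib_left ac_simps)
  then show ?thesis
    by (simp add: coeff_sum coeff_minus_one_power_times)
qed

text \<open>Trades membership of a difference in \<open>S\<close> for divisibility within
  \<open>S\<close>, the condition that also governs the coefficients of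
  \<open>tpow e * g\<close>.\<close>

lemma complex_at_eq: "complex_at E m = {J. J \<subseteq> E \<and> (\<exists>k. m = \<Sum>J + k)}"
  by (simp add: complex_at_def diff_in_range_iff)

lemma supp_eq: "supp E m = {e \<in> E. \<exists>k. m = e + k}"
  by (simp add: supp_def diff_in_range_iff)

lemma coeff_poincare_series_times_prod:
  fixes E :: "'a::fg_positive_cancel_semigroup set"
  assumes "finite E"
  shows "coeff (poincare_series * (\<Prod>e\<in>E. 1 - tpow e)) m = (\<Sum>J\<in>complex_at E m. (-1) ^ card J)"
proof -
  \<comment> \<open>All coefficients of the Poincare series are 1, so its shift by
    \<open>\<Sum>J\<close> has coefficient 1 exactly where the subtraction stays in
    \<open>S\<close>.\<close>
  have "coeff (tpow (\<Sum>J) * poincare_series) m = of_bool (J \<in> complex_at E m)"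
    if "J \<in> Pow E" for J
    using that by (auto simp: coeff_tpow_times poincare_series_def complex_at_eq)
  then have "coeff (poincare_series * (\<Prod>e\<in>E. 1 - tpow e)) m =
      (\<Sum>J\<in>Pow E. (-1) ^ card J * of_bool (J \<in> complex_at E m))"
    unfolding coeff_times_prod_one_minus_tpow[OF assms] by (intro sum.cong) auto
  also have "\<dots> = (\<Sum>J\<in>complex_at E m. (-1) ^ card J)"
    using assms by (intro sum.mono_neutral_cong_right) (auto simp: complex_at_def)
  finally show ?thesis .
qed

lemma sum_Pow_minus_one_power_card:
  assumes "finite V" "V \<noteq> {}"
  shows "(\<Sum>J\<in>Pow V. (-1) ^ card J) = (0 :: int)"
proof -
  \<comment> \<open>The alternating sum is the expansion of a product of factors
    \<open>1 - 1\<close>, which vanishes because \<open>V\<close> is nonempty.\<close>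
  have "(\<Prod>x\<in>V. 1 - 1) = (\<Sum>J\<in>Pow V. (-1 :: int) ^ card J * (\<Prod>x\<in>J. 1) * (\<Prod>x\<in>V - J. 1))"
    using assms(1) by (rule prod_diff_conv_sum)
  then show ?thesis
    using assms by (simp add: zero_power card_gt_0_iff)
qed

text \<open>Serves both formulas, with \<open>V = supp E m\<close> for the first and
  \<open>V = E\<close> for the second.\<close>

lemma reduced_euler_char_dual:
  assumes "finite V" "V \<noteq> {}" "T \<subseteq> Pow V"
  shows "(-1) ^ card V * reduced_euler_char {J. J \<subseteq> V \<and> V - J \<notin> T} = (\<Sum>J\<in>T. (-1) ^ card J)"
proof -
  have "(-1) ^ card V * reduced_euler_char {J. J \<subseteq> V \<and> V - J \<notin> T} =
      (\<Sum>J\<in>{J. J \<subseteq> V \<and> V - J \<notin> T}. (-1) ^ card V * (-1) ^ (card J + 1))"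
    by (simp add: reduced_euler_char_def sum_distrib_left)
  also have "\<dots> = (\<Sum>J\<in>Pow V - T. - ((-1) ^ card J))"
  proof (rule sum.reindex_bij_witness[of _ "\<lambda>J. V - J" "\<lambda>J. V - J"])
    fix J
    assume J: "J \<in> {J. J \<subseteq> V \<and> V - J \<notin> T}"
    then have "card V = card (V - J) + card J"
      using assms(1) card_Int_Diff[of V J] by (simp add: Int_absorb1)
    \<comment> \<open>The two factors \<open>(-1) ^ card J\<close> cancel; the minus sign comes from
      the \<open>+ 1\<close> in the exponent.\<close>
    then show "- ((-1) ^ card (V - J)) = (-1) ^ card V * (-1 :: int) ^ (card J + 1)"
      by (simp add: power_add flip: power_mult_distrib)
  qed (auto simp: double_diff)
  also have "\<dots> = (\<Sum>J\<in>T. (-1) ^ card J) - (\<Sum>J\<in>Pow V. (-1) ^ card J)"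
    using assms by (simp add: sum_negf sum_diff)
  finally show ?thesis
    using assms by (simp add: sum_Pow_minus_one_power_card)
qed

text \<open>Splitting one vertex \<open>e\<close> off the sum over a face leaves a witness that
  \<open>m - e\<close> lies in \<open>S\<close>. Hence the support can serve as the vertex
  set.\<close>

lemma complex_at_subset_Pow_supp:
  assumes "finite E"
  shows "complex_at E m \<subseteq> Pow (supp E m)"
proof (intro subsetI PowI)
  fix J e
  assume "J \<in> complex_at E m" "e \<in> J"
  then obtain k where J: "J \<subseteq> E" "m = \<Sum>J + k"
    by (auto simp: complex_at_eq)
  then have "m = e + (\<Sum>(J - {e}) + k)"
    using assms \<open>e \<in> J\<close> by (simp add: sum.remove[of J e] finite_subset add.assoc)
  then show "e \<in> supp E m"
    using J(1) \<open>e \<in> J\<close> by (auto simp: supp_eq)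
qed

lemma dual_euler_char_eq:
  assumes "finite E"
  shows "(-1) ^ card (supp E m) * dual_euler_char E m = (\<Sum>J\<in>complex_at E m. (-1) ^ card J)"
proof (cases "complex_at E m = {{}}")
  case True
  \<comment> \<open>The conventional value 1 is the right one: the support is empty, and the empty
    face alone contributes 1 to the sum.\<close>
  have "{e} \<in> complex_at E m" if "e \<in> supp E m" for e
    using that by (simp add: complex_at_eq supp_eq)
  with True have "supp E m = {}"
    by blast
  with True show ?thesis
    by (simp add: dual_euler_char_def)
next
  case False
  have sub: "complex_at E m \<subseteq> Pow (supp E m)"
    using assms by (rule complex_at_subset_Pow_supp)
  moreover have "{} \<in> complex_at E m"
    by (simp add: complex_at_eq)
  \<comment> \<open>With empty support, the complex would have \<open>{}\<close> as its only
    face.\<close>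
  ultimately have "supp E m \<noteq> {}"
    using False by auto
  moreover have "finite (supp E m)"
    using assms by (simp add: supp_def)
  ultimately show ?thesis
    using False sub by (simp add: dual_euler_char_def alexander_dual_def reduced_euler_char_dual)
qed

text \<open>Clears the denominator, which is a unit since \<open>0 \<notin> E\<close>.\<close>

lemma eq_divide_prod_one_minus_tpow:
  fixes E :: "'a::fg_positive_cancel_semigroup set"
  assumes "0 \<notin> E" "f * (\<Prod>e\<in>E. 1 - tpow e) = g"
  shows "f = g / (\<Prod>e\<in>E. 1 - tpow e)"
  unfolding divide_formal_series_def assms(2)[symmetric] mult.assoc
    prod_one_minus_tpow_unit[OF assms(1)] by simp

theorem theorem4p2:
  fixes E :: "'a::fg_positive_cancel_semigroup set"
  assumes "finite E" and "E \<noteq> {}" and "E \<subseteq> UNIV - {0}"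
  shows "poincare_series =
      formal_sum (\<lambda>m. (-1) ^ card (supp E m) * dual_euler_char E m) / (\<Prod>e\<in>E. 1 - tpow e)
    \<and> poincare_series =
      formal_sum (\<lambda>m. (-1) ^ card E * reduced_euler_char (relative_alexander_dual E m)) /
        (\<Prod>e\<in>E. 1 - tpow e)"
proof (intro conjI eq_divide_prod_one_minus_tpow formal_series_eqI)
  fix m
  show "coeff (poincare_series * (\<Prod>e\<in>E. 1 - tpow e)) m =
      coeff (formal_sum (\<lambda>m. (-1) ^ card (supp E m) * dual_euler_char E m)) m"
    using assms(1) by (simp add: coeff_poincare_series_times_prod dual_euler_char_eq)
  \<comment> \<open>For the relative dual the vertex set is \<open>E\<close>, nonempty for every
    \<open>m\<close>, so no case of empty support arises.\<close>
  have "complex_at E m \<subseteq> Pow E"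
    by (auto simp: complex_at_def)
  then show "coeff (poincare_series * (\<Prod>e\<in>E. 1 - tpow e)) m =
      coeff (formal_sum (\<lambda>m. (-1) ^ card E * reduced_euler_char (relative_alexander_dual E m))) m"
    using assms(1,2)
    by (simp add: coeff_poincare_series_times_prod relative_alexander_dual_def
        reduced_euler_char_dual)
qed (use assms(3) in auto)

end
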